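(* Let $P$ be almost a join-based lattice. Suppose $P$ has reduced integral homology in dimension $k\geq 0$, that is, $\widetilde H_k(\Delta(P);\mathbb{Z})\neq 0$. Then there are at least $(k+2)!$ maximal chains in $P$ of length at least $k$.
   Context: All posets are finite. A finite poset $P$ is almost a join-based lattice if, after adjoining a new topmost element $\hat 1$ (strictly above every element of $P$, adjoined even if $P$ already has a greatest element), the poset $P\cup\{\hat 1\}$ is a join semi-lattice, i.e. every two elements have a least upper bound. $\Delta(P)$ is the order complex of $P$: the simplicial complex whose simplices are the chains (totally ordered subsets) of $P$. The length of a chain is one less than its number of elements. $\widetilde H_k$ denotes reduced simplicial homology. *)

theory Defs
  imports
    "HOL-Algebra.Lattice"
    "HOL-Algebra.Elementary_Groups"
    "HOL-Algebra.Free_Abelian_Groups"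
begin

section \<open>Reduced simplicial homology\<close>

text \<open>
  An abstract simplicial complex is a set \<open>K\<close> of finite vertex sets closed under taking subsets;
  the empty set is its simplex of dimension \<open>-1\<close>, so that the chain complex below is the augmented
  one. Orientations come from a relation \<open>lt\<close> that is a strict total order on every simplex.
\<close>

definition simplices :: "'a set set \<Rightarrow> int \<Rightarrow> 'a set set"
  where "simplices K p = {s \<in> K. finite s \<and> int (card s) = p + 1}"

definition simplicial_chain_group :: "'a set set \<Rightarrow> int \<Rightarrow> ('a set \<Rightarrow>\<^sub>0 int) monoid"
  where "simplicial_chain_group K p = free_Abelian_group (simplices K p)"

text \<open>
  For a simplex \<open>x\<^sub>0 < \<dots> < x\<^sub>p\<close> the exponent of the face opposite to \<open>x\<^sub>i\<close> is the number \<open>i\<close> of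
  vertices smaller than \<open>x\<^sub>i\<close>. On \<open>0\<close>-simplices this is the augmentation.
\<close>

definition simplicial_boundary :: "('a \<Rightarrow> 'a \<Rightarrow> bool) \<Rightarrow> ('a set \<Rightarrow>\<^sub>0 int) \<Rightarrow> ('a set \<Rightarrow>\<^sub>0 int)"
  where "simplicial_boundary lt =
    frag_extend (\<lambda>s. \<Sum>x\<in>s. frag_cmul ((-1) ^ card {y \<in> s. lt y x}) (frag_of (s - {x})))"

definition simplicial_cycles :: "('a \<Rightarrow> 'a \<Rightarrow> bool) \<Rightarrow> 'a set set \<Rightarrow> int \<Rightarrow> ('a set \<Rightarrow>\<^sub>0 int) set"
  where "simplicial_cycles lt K p =
    kernel (simplicial_chain_group K p) (simplicial_chain_group K (p - 1)) (simplicial_boundary lt)"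

definition simplicial_boundaries :: "('a \<Rightarrow> 'a \<Rightarrow> bool) \<Rightarrow> 'a set set \<Rightarrow> int \<Rightarrow> ('a set \<Rightarrow>\<^sub>0 int) set"
  where "simplicial_boundaries lt K p =
    simplicial_boundary lt ` carrier (simplicial_chain_group K (p + 1))"

definition reduced_simplicial_homology ::
    "('a \<Rightarrow> 'a \<Rightarrow> bool) \<Rightarrow> 'a set set \<Rightarrow> int \<Rightarrow> ('a set \<Rightarrow>\<^sub>0 int) set monoid"
  where "reduced_simplicial_homology lt K p =
    subgroup_generated (simplicial_chain_group K p) (simplicial_cycles lt K p)
      Mod simplicial_boundaries lt K p"


section \<open>Chains and order complexes\<close>

definition order_chain :: "('a, 'b) gorder_scheme \<Rightarrow> 'a set \<Rightarrow> bool"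
  where "order_chain P C \<longleftrightarrow>
    C \<subseteq> carrier P \<and> (\<forall>x\<in>C. \<forall>y\<in>C. x \<sqsubseteq>\<^bsub>P\<^esub> y \<or> y \<sqsubseteq>\<^bsub>P\<^esub> x)"

definition maximal_order_chain :: "('a, 'b) gorder_scheme \<Rightarrow> 'a set \<Rightarrow> bool"
  where "maximal_order_chain P C \<longleftrightarrow>
    order_chain P C \<and> (\<forall>D. order_chain P D \<and> C \<subseteq> D \<longrightarrow> D = C)"

definition chain_length :: "'a set \<Rightarrow> int"
  where "chain_length C = int (card C) - 1"

definition order_complex :: "('a, 'b) gorder_scheme \<Rightarrow> 'a set set"
  where "order_complex P = {C. order_chain P C}"

definition reduced_order_homology ::
    "('a, 'b) gorder_scheme \<Rightarrow> int \<Rightarrow> ('a set \<Rightarrow>\<^sub>0 int) set monoid"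
  where "reduced_order_homology P p = reduced_simplicial_homology (lless P) (order_complex P) p"


section \<open>Almost join-based lattices\<close>

text \<open>\<^const>\<open>None\<close> is the new topmost element.\<close>

definition adjoin_top :: "('a, 'b) gorder_scheme \<Rightarrow> 'a option gorder"
  where "adjoin_top P =
    \<lparr>carrier = insert None (Some ` carrier P),
     eq = (=),
     le = (\<lambda>x y. case y of None \<Rightarrow> True
                 | Some b \<Rightarrow> (case x of None \<Rightarrow> False | Some a \<Rightarrow> a \<sqsubseteq>\<^bsub>P\<^esub> b))\<rparr>"

definition almost_join_based_lattice :: "('a, 'b) gorder_scheme \<Rightarrow> bool"
  where "almost_join_based_lattice P \<longleftrightarrow>
    partial_order P \<and> upper_semilattice (adjoin_top P)"


section \<open>The homology of an order complex is a group\<close>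

lemma simplicial_boundary_of:
  "simplicial_boundary lt (frag_of s) =
    (\<Sum>x\<in>s. frag_cmul ((-1) ^ card {y \<in> s. lt y x}) (frag_of (s - {x})))"
  by (simp add: simplicial_boundary_def)

lemma simplicial_boundary_diff:
  "simplicial_boundary lt (a - b) = simplicial_boundary lt a - simplicial_boundary lt b"
  by (simp add: simplicial_boundary_def frag_extend_diff)

lemma simplicial_boundary_add:
  "simplicial_boundary lt (a + b) = simplicial_boundary lt a + simplicial_boundary lt b"
  by (simp add: simplicial_boundary_def frag_extend_add)

lemma simplicial_boundary_0 [simp]: "simplicial_boundary lt 0 = 0"
  by (simp add: simplicial_boundary_def)

lemma simplicial_boundary_closed:
  assumes K: "\<And>s t. s \<in> K \<Longrightarrow> t \<subseteq> s \<Longrightarrow> t \<in> K"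
    and c: "c \<in> carrier (simplicial_chain_group K p)"
  shows "simplicial_boundary lt c \<in> carrier (simplicial_chain_group K (p - 1))"
proof -
  have "Poly_Mapping.keys c \<subseteq> simplices K p"
    using c by (simp add: simplicial_chain_group_def)
  then show ?thesis
  proof (induction c rule: frag_induction)
    case zero
    show ?case by (simp add: simplicial_chain_group_def)
  next
    case (diff a b)
    then show ?case
      by (auto simp: simplicial_chain_group_def simplicial_boundary_diff dest: subsetD [OF keys_diff])
  next
    case (one s)
    have "frag_cmul ((-1) ^ n) (frag_of (s - {x})) \<in> carrier (simplicial_chain_group K (p - 1))"
      if "x \<in> s" for x n
    proof -
      have s: "s \<in> K" "finite s" "int (card s) = p + 1"
        using one by (simp_all add: simplices_def)
      moreover have "s - {x} \<in> K"
        using s(1) by (rule K) blast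
      moreover have "card s = Suc (card (s - {x}))"
        using card.remove [OF s(2) that] .
      ultimately have "s - {x} \<in> simplices K (p - 1)"
        by (simp add: simplices_def)
      then show ?thesis
        using keys_cmul [of "(-1) ^ n" "frag_of (s - {x})"]
        by (auto simp: simplicial_chain_group_def)
    qed
    then show ?case
      unfolding simplicial_boundary_of simplicial_chain_group_def
      by (intro sum_closed_free_Abelian_group) auto
  qed
qed

lemma simplicial_boundary_boundary_of:
  assumes fin: "finite s"
    and total: "\<And>x y. x \<in> s \<Longrightarrow> y \<in> s \<Longrightarrow> x \<noteq> y \<Longrightarrow> lt x y \<longleftrightarrow> \<not> lt y x"
  shows "simplicial_boundary lt (simplicial_boundary lt (frag_of s)) = 0"
proof -
  define pos where "pos t x = card {y \<in> t. lt y x}" for t x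
  define T where "T x y = frag_cmul ((-1) ^ (pos s x + pos (s - {x}) y)) (frag_of (s - {x} - {y}))"
    for x y
  have T1: "T x y = - T y x" if xy: "x \<in> s" "y \<in> s" "lt x y" "\<not> lt y x" "x \<noteq> y" for x y
  proof -
    have "{z \<in> s. lt z y} = insert x {z \<in> s - {x}. lt z y}"
      using xy by auto
    then have "pos s y = Suc (pos (s - {x}) y)"
      using fin by (simp add: pos_def)
    moreover have "{z \<in> s - {y}. lt z x} = {z \<in> s. lt z x}"
      using xy by auto
    then have "pos (s - {y}) x = pos s x"
      by (simp add: pos_def)
    moreover have "s - {x} - {y} = s - {y} - {x}"
      by auto
    ultimately show ?thesis
      by (simp add: T_def add.commute)
  qed
  have T: "T x y = - T y x" if "x \<in> s" "y \<in> s" "x \<noteq> y" for x y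
    using T1 [of x y] T1 [of y x] total [of x y] that by (cases "lt x y") auto
  define S where "S = (\<Sum>x\<in>s. \<Sum>y\<in>s. if x = y then 0 else T x y)"
  have "simplicial_boundary lt (simplicial_boundary lt (frag_of s))
      = (\<Sum>x\<in>s. \<Sum>y\<in>s - {x}. T x y)"
    unfolding simplicial_boundary_def frag_extend_of frag_extend_sum [OF fin] o_def
      frag_extend_cmul T_def pos_def
    by (intro sum.cong refl) (simp add: frag_cmul_sum power_add)
  also have "\<dots> = S"
    unfolding S_def
  proof (rule sum.cong [OF refl])
    fix x assume "x \<in> s"
    then show "(\<Sum>y\<in>s - {x}. T x y) = (\<Sum>y\<in>s. if x = y then 0 else T x y)"
      using fin by (intro sum.mono_neutral_cong_left) auto
  qed
  finally have eq: "simplicial_boundary lt (simplicial_boundary lt (frag_of s)) = S" .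
  have "S = (\<Sum>y\<in>s. \<Sum>x\<in>s. if x = y then 0 else T x y)"
    unfolding S_def by (rule sum.swap)
  also have "\<dots> = (\<Sum>y\<in>s. \<Sum>x\<in>s. - (if y = x then 0 else T y x))"
    by (intro sum.cong refl) (auto intro: T)
  also have "\<dots> = - S"
    unfolding S_def by (simp add: sum_negf)
  finally have "S = - S" .
  then have "Poly_Mapping.lookup S i = - Poly_Mapping.lookup S i" for i
    by (metis lookup_uminus)
  then have "S = 0"
    by (intro poly_mapping_eqI) (metis equal_neg_zero lookup_zero)
  with eq show ?thesis by simp
qed

lemma simplicial_boundary_boundary:
  assumes total: "\<And>s x y. s \<in> K \<Longrightarrow> x \<in> s \<Longrightarrow> y \<in> s \<Longrightarrow> x \<noteq> y \<Longrightarrow> lt x y \<longleftrightarrow> \<not> lt y x"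
    and c: "c \<in> carrier (simplicial_chain_group K p)"
  shows "simplicial_boundary lt (simplicial_boundary lt c) = 0"
proof -
  have "Poly_Mapping.keys c \<subseteq> simplices K p"
    using c by (simp add: simplicial_chain_group_def)
  then show ?thesis
  proof (induction c rule: frag_induction)
    case (one s)
    then show ?case
      using total by (intro simplicial_boundary_boundary_of) (auto simp: simplices_def)
  qed (auto simp: simplicial_boundary_diff)
qed

lemma comm_group_reduced_simplicial_homology:
  assumes K: "\<And>s t. s \<in> K \<Longrightarrow> t \<subseteq> s \<Longrightarrow> t \<in> K"
    and total: "\<And>s x y. s \<in> K \<Longrightarrow> x \<in> s \<Longrightarrow> y \<in> s \<Longrightarrow> x \<noteq> y \<Longrightarrow> lt x y \<longleftrightarrow> \<not> lt y x"
  shows "comm_group (reduced_simplicial_homology lt K p)"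
proof -
  let ?C = "\<lambda>q. simplicial_chain_group K q" and ?d = "simplicial_boundary lt"
  have grp: "group (?C q)" "comm_group (?C q)" for q
    by (simp_all add: simplicial_chain_group_def abelian_free_Abelian_group)
  have hom: "group_hom (?C q) (?C (q - 1)) ?d" for q
    using grp simplicial_boundary_closed [OF K]
    by (auto simp: group_hom_def group_hom_axioms_def hom_def simplicial_boundary_add
        simplicial_chain_group_def)
  let ?Z = "simplicial_cycles lt K p" and ?B = "simplicial_boundaries lt K p"
  have Z: "subgroup ?Z (?C p)"
    unfolding simplicial_cycles_def by (rule group_hom.subgroup_kernel [OF hom])
  have B: "subgroup ?B (?C p)"
    using group_hom.img_is_subgroup [OF hom [of "p + 1"]] by (simp add: simplicial_boundaries_def)
  have "?B \<subseteq> ?Z"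
  proof
    fix b assume b: "b \<in> ?B"
    then obtain c where "c \<in> carrier (?C (p + 1))" "b = ?d c"
      by (auto simp: simplicial_boundaries_def)
    moreover from this have "?d (?d c) = 0"
      using total by (intro simplicial_boundary_boundary [of K lt c "p + 1"]) blast+
    ultimately have "?d b = 0"
      by simp
    then show "b \<in> ?Z"
      using subsetD [OF subgroup.subset [OF B] b]
      by (simp add: simplicial_cycles_def kernel_def simplicial_chain_group_def)
  qed
  then have "subgroup ?B (subgroup_generated (?C p) ?Z)"
    by (rule group.subgroup_of_subgroup_generated [OF grp(1) _ B])
  moreover have "comm_group (subgroup_generated (?C p) ?Z)"
    using grp group.abelian_subgroup_generated by blast
  ultimately show ?thesis
    unfolding reduced_simplicial_homology_def by (simp add: comm_group.abelian_FactGroup)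
qed

lemma comm_group_reduced_order_homology:
  assumes "partial_order P"
  shows "comm_group (reduced_order_homology P p)"
proof -
  interpret partial_order P by fact
  show ?thesis
    unfolding reduced_order_homology_def
  proof (rule comm_group_reduced_simplicial_homology)
    show "t \<in> order_complex P" if "s \<in> order_complex P" "t \<subseteq> s" for s t
      using that unfolding order_complex_def order_chain_def by blast
  next
    show "x \<sqsubset>\<^bsub>P\<^esub> y \<longleftrightarrow> \<not> y \<sqsubset>\<^bsub>P\<^esub> x"
      if s: "s \<in> order_complex P" and xy: "x \<in> s" "y \<in> s" "x \<noteq> y" for s x y
    proof -
      have "x \<in> carrier P" "y \<in> carrier P" "x \<sqsubseteq>\<^bsub>P\<^esub> y \<or> y \<sqsubseteq>\<^bsub>P\<^esub> x"
        using s xy unfolding order_complex_def order_chain_def by blast+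
      then show ?thesis
        using xy le_antisym [of x y] unfolding lless_eq by blast
    qed
  qed
qed

end

theory Submission
  imports Defs
begin

text \<open>
  If \<open>U\<close> and \<open>V\<close> are up-sets, then \<open>\<Delta>(U \<union> V) = \<Delta>(U) \<union> \<Delta>(V)\<close>, so the Mayer--Vietoris argument
  applies. Since two principal up-sets meet in a principal up-set or not at all, it shows by
  induction that a union of at most \<open>k + 1\<close> principal up-sets has no homology in dimension \<open>k\<close>;
  hence a poset with homology in dimension \<open>k\<close> has at least \<open>k + 2\<close> minimal elements \<open>a\<close>.
  If the elements above each of them have homology in dimension \<open>k - 1\<close>, induction
  yields \<open>(k + 2) (k + 1)!\<close> chains. If they do not for some \<open>a\<close>, then, again by Mayer--Vietoris,
  deleting \<open>a\<close> preserves the homology in dimension \<open>k\<close>, and it does not increase the number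
  of long maximal chains.
\<close>

section \<open>Vanishing of simplicial homology\<close>

text \<open>Vanishing is an inclusion between sets of chains, so that the exactness arguments below
  can manipulate chains directly, with no cosets or connecting maps.\<close>

definition homology_vanishes :: "('a \<Rightarrow> 'a \<Rightarrow> bool) \<Rightarrow> 'a set set \<Rightarrow> int \<Rightarrow> bool"
  where "homology_vanishes lt K p \<longleftrightarrow> simplicial_cycles lt K p \<subseteq> simplicial_boundaries lt K p"

section \<open>Cycles and boundaries in terms of supports\<close>

lemma in_simplicial_cycles_iff:
  "c \<in> simplicial_cycles lt K p \<longleftrightarrow>
    Poly_Mapping.keys c \<subseteq> simplices K p \<and> simplicial_boundary lt c = 0"
  by (simp add: simplicial_cycles_def kernel_def simplicial_chain_group_def)

lemma in_simplicial_boundaries_iff: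
  "c \<in> simplicial_boundaries lt K p \<longleftrightarrow>
    (\<exists>d. Poly_Mapping.keys d \<subseteq> simplices K (p + 1) \<and> simplicial_boundary lt d = c)"
  by (simp add: simplicial_boundaries_def simplicial_chain_group_def image_iff Bex_def) metis

lemma homology_vanishesI:
  assumes "\<And>c. Poly_Mapping.keys c \<subseteq> simplices K p \<Longrightarrow> simplicial_boundary lt c = 0 \<Longrightarrow>
    \<exists>d. Poly_Mapping.keys d \<subseteq> simplices K (p + 1) \<and> simplicial_boundary lt d = c"
  shows "homology_vanishes lt K p"
  using assms unfolding homology_vanishes_def
  by (auto simp: in_simplicial_cycles_iff in_simplicial_boundaries_iff)

lemma homology_vanishesE:
  assumes "homology_vanishes lt K p" "Poly_Mapping.keys c \<subseteq> simplices K p"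
    "simplicial_boundary lt c = 0"
  obtains d where "Poly_Mapping.keys d \<subseteq> simplices K (p + 1)" "simplicial_boundary lt d = c"
  using assms unfolding homology_vanishes_def
  by (meson in_simplicial_cycles_iff in_simplicial_boundaries_iff subsetD)

lemma keys_simplicial_boundary:
  assumes "\<And>s t. s \<in> K \<Longrightarrow> t \<subseteq> s \<Longrightarrow> t \<in> K" "Poly_Mapping.keys c \<subseteq> simplices K p"
  shows "Poly_Mapping.keys (simplicial_boundary lt c) \<subseteq> simplices K (p - 1)"
  using simplicial_boundary_closed [of K c p lt] assms by (simp add: simplicial_chain_group_def)

lemma simplicial_boundary_minus: "simplicial_boundary lt (- c) = - simplicial_boundary lt c"
  using simplicial_boundary_diff [of lt 0 c] by simp

lemma keys_add_subset:
  "Poly_Mapping.keys a \<subseteq> S \<Longrightarrow> Poly_Mapping.keys b \<subseteq> S \<Longrightarrow> Poly_Mapping.keys (a + b) \<subseteq> S"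
  using Poly_Mapping.keys_add [of a b] by blast

lemma keys_diff_subset:
  "Poly_Mapping.keys a \<subseteq> S \<Longrightarrow> Poly_Mapping.keys b \<subseteq> S \<Longrightarrow> Poly_Mapping.keys (a - b) \<subseteq> S"
  using keys_diff [of a b] by blast

text \<open>This is the stretch of the Mayer-Vietoris sequence in which the homology of the union
  sits between that of the two pieces and that of the intersection one dimension lower, carried out
  on chains.\<close>

lemma homology_vanishes_Un:
  assumes K: "\<And>s t. s \<in> K \<Longrightarrow> t \<subseteq> s \<Longrightarrow> t \<in> K" and L: "\<And>s t. s \<in> L \<Longrightarrow> t \<subseteq> s \<Longrightarrow> t \<in> L"
    and total: "\<And>s x y. s \<in> K \<Longrightarrow> x \<in> s \<Longrightarrow> y \<in> s \<Longrightarrow> x \<noteq> y \<Longrightarrow> lt x y \<longleftrightarrow> \<not> lt y x"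
    and vK: "homology_vanishes lt K p" and vL: "homology_vanishes lt L p"
    and vKL: "homology_vanishes lt (K \<inter> L) (p - 1)"
  shows "homology_vanishes lt (K \<union> L) p"
proof (rule homology_vanishesI)
  fix c assume c: "Poly_Mapping.keys c \<subseteq> simplices (K \<union> L) p" "simplicial_boundary lt c = 0"
  let ?d = "simplicial_boundary lt"
  have Un: "simplices (K \<union> L) q = simplices K q \<union> simplices L q"
    and Int: "simplices (K \<inter> L) q = simplices K q \<inter> simplices L q" for q
    by (auto simp: simplices_def)
  \<comment> \<open>Each simplex of \<open>c\<close> lies in \<open>K\<close> or in
    \<open>L\<close>; the chain is split accordingly. Since \<open>c\<close> is a cycle,
    \<open>?d u\<close> equals \<open>- ?d v\<close> and is thus supported in both
    complexes.\<close>
  obtain u v where u: "Poly_Mapping.keys u \<subseteq> simplices K p"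
    and v: "Poly_Mapping.keys v \<subseteq> simplices L p" and uv: "u + v = c"
    using frag_split [of c "simplices K p" "simplices L p"] c(1) Un by metis
  have du: "?d u = - ?d v"
    using c(2) uv by (metis simplicial_boundary_add eq_neg_iff_add_eq_0)
  have "Poly_Mapping.keys (?d u) \<subseteq> simplices K (p - 1)"
    by (rule keys_simplicial_boundary [OF K u])
  moreover have "Poly_Mapping.keys (?d v) \<subseteq> simplices L (p - 1)"
    by (rule keys_simplicial_boundary [OF L v])
  ultimately have "Poly_Mapping.keys (?d u) \<subseteq> simplices (K \<inter> L) (p - 1)"
    by (simp add: Int du)
  moreover have "u \<in> carrier (simplicial_chain_group K p)"
    using u by (simp add: simplicial_chain_group_def)
  then have "?d (?d u) = 0"
    by (rule simplicial_boundary_boundary [rotated]) (rule total)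
  ultimately obtain w where w: "Poly_Mapping.keys w \<subseteq> simplices (K \<inter> L) p" "?d w = ?d u"
    using homology_vanishesE [OF vKL, of "?d u"] by auto
  \<comment> \<open>Moving \<open>w\<close> from one part to the other turns both into cycles, in
    \<open>K\<close> and in \<open>L\<close>, without changing their sum \<open>c\<close>.\<close>
  have "Poly_Mapping.keys (u - w) \<subseteq> simplices K p"
    using u w(1) by (intro keys_diff_subset) (auto simp: Int)
  moreover have "?d (u - w) = 0"
    by (simp add: simplicial_boundary_diff w)
  ultimately obtain x where x: "Poly_Mapping.keys x \<subseteq> simplices K (p + 1)" "?d x = u - w"
    using homology_vanishesE [OF vK] by blast
  have "Poly_Mapping.keys (v + w) \<subseteq> simplices L p"
    using v w(1) by (intro keys_add_subset) (auto simp: Int)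
  moreover have "?d (v + w) = 0"
    by (simp add: simplicial_boundary_add w du)
  ultimately obtain y where y: "Poly_Mapping.keys y \<subseteq> simplices L (p + 1)" "?d y = v + w"
    using homology_vanishesE [OF vL] by blast
  have "Poly_Mapping.keys (x + y) \<subseteq> simplices (K \<union> L) (p + 1)"
    using x(1) y(1) by (intro keys_add_subset) (auto simp: Un)
  moreover have "?d (x + y) = c"
    by (simp add: simplicial_boundary_add x y flip: uv)
  ultimately show "\<exists>d. Poly_Mapping.keys d \<subseteq> simplices (K \<union> L) (p + 1) \<and> ?d d = c"
    by blast
qed

text \<open>A cone is acyclic in the augmented complex, so \<open>p\<close> is arbitrary, and in
  particular may be -1.\<close>

lemma homology_vanishes_cone:
  assumes cone: "\<And>s. s \<in> K \<Longrightarrow> insert a s \<in> K"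
    and less: "\<And>s x. s \<in> K \<Longrightarrow> x \<in> s \<Longrightarrow> x \<noteq> a \<Longrightarrow> lt a x \<and> \<not> lt x a"
    and irrefl: "\<not> lt a a"
  shows "homology_vanishes lt K p"
proof (rule homology_vanishesI)
  fix c assume c: "Poly_Mapping.keys c \<subseteq> simplices K p" "simplicial_boundary lt c = 0"
  let ?d = "simplicial_boundary lt"
  \<comment> \<open>Adding the apex is a contracting chain homotopy; as the apex comes first, it carries sign \<open>+1\<close>.\<close>
  define h where "h = frag_extend (\<lambda>s. if a \<in> s then 0 else frag_of (insert a s))"
  have h_of: "h (frag_of s) = (if a \<in> s then 0 else frag_of (insert a s))" for s
    by (simp add: h_def)
  \<comment> \<open>The homotopy identity is linear, so it is checked on single simplices. On a
    cycle it says that \<open>h\<close> yields a chain bounded by that cycle.\<close>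
  have homotopy: "?d (h b) + h (?d b) = b" if "Poly_Mapping.keys b \<subseteq> simplices K p" for b
    using that
  proof (induction b rule: frag_induction)
    case zero
    show ?case by (simp add: h_def)
  next
    case (diff b b')
    have "?d (h (b - b')) + h (?d (b - b')) = (?d (h b) + h (?d b)) - (?d (h b') + h (?d b'))"
      by (simp add: h_def frag_extend_diff simplicial_boundary_diff)
    with diff show ?case
      by simp
  next
    case (one s)
    then have s: "s \<in> K" "finite s"
      by (auto simp: simplices_def)
    define e where "e t x = (-1 :: int) ^ card {y \<in> t. lt y x}" for t x
    have d_of: "?d (frag_of t) = (\<Sum>x\<in>t. frag_cmul (e t x) (frag_of (t - {x})))" for t
      by (simp add: simplicial_boundary_of e_def)
    have h_d: "h (?d (frag_of s)) = (\<Sum>x\<in>s. frag_cmul (e s x) (h (frag_of (s - {x}))))"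
      unfolding d_of h_def by (simp add: frag_extend_sum s frag_extend_cmul o_def)
    show ?case
    proof (cases "a \<in> s")
      case True
      have "{y \<in> s. lt y a} = {}"
        using less [OF s(1)] irrefl by blast
      then have [simp]: "e s a = 1"
        unfolding e_def by (simp only: card.empty power_0)
      \<comment> \<open>Faces that still contain \<open>a\<close> are killed by \<open>h\<close>.
        Only the face opposite to \<open>a\<close> survives, and adding \<open>a\<close> to it gives
        back \<open>s\<close>.\<close>
      have "h (?d (frag_of s)) = (\<Sum>x\<in>s. if x = a then frag_of s else 0)"
        unfolding h_d by (intro sum.cong refl) (auto simp: h_of True insert_absorb)
      with True s show ?thesis
        by (simp add: h_of)
    next
      case False
      have "{y \<in> insert a s. lt y a} = {}"
        using less [OF s(1)] irrefl False by blast
      then have ea: "e (insert a s) a = 1"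
        unfolding e_def by (simp only: card.empty power_0)
      \<comment> \<open>The apex precedes \<open>x\<close> and raises its position by one. The
        flipped signs make every face other than \<open>s\<close> cancel against
        \<open>h (?d (frag_of s))\<close>.\<close>
      have e: "e (insert a s) x = - e s x" if "x \<in> s" for x
      proof -
        have "{y \<in> insert a s. lt y x} = insert a {y \<in> s. lt y x}"
          using less [OF s(1) that] that False by auto
        then show ?thesis
          using s False by (simp add: e_def)
      qed
      have "?d (h (frag_of s)) = frag_of s +
          (\<Sum>x\<in>s. frag_cmul (e (insert a s) x) (frag_of (insert a s - {x})))"
        using False s by (simp add: h_of d_of ea)
      also have "(\<Sum>x\<in>s. frag_cmul (e (insert a s) x) (frag_of (insert a s - {x}))) =
          (\<Sum>x\<in>s. - frag_cmul (e s x) (frag_of (insert a (s - {x}))))"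
        using False by (intro sum.cong refl) (auto simp: e insert_Diff_if)
      also have "\<dots> = - (\<Sum>x\<in>s. frag_cmul (e s x) (frag_of (insert a (s - {x}))))"
        by (rule sum_negf)
      also have "\<dots> = - h (?d (frag_of s))"
        unfolding h_d using False by (simp add: h_of)
      finally show ?thesis by simp
    qed
  qed
  have "Poly_Mapping.keys (h b) \<subseteq> simplices K (p + 1)" if "Poly_Mapping.keys b \<subseteq> simplices K p" for b
    using that
  proof (induction b rule: frag_induction)
    case (one s)
    then show ?case
      using cone by (auto simp: h_of simplices_def)
  next
    case (diff b b')
    then show ?case
      by (simp add: h_def frag_extend_diff keys_diff_subset)
  qed (simp add: h_def)
  moreover have "?d (h c) = c"
    using homotopy [OF c(1)] c(2) by (simp add: h_def)
  ultimately show "\<exists>d. Poly_Mapping.keys d \<subseteq> simplices K (p + 1) \<and> ?d d = c"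
    using c(1) by blast
qed

text \<open>If every cycle bounds, the boundaries form the only coset. Used by contraposition to
  pass from the nontrivial homology group to chains.\<close>

lemma trivial_reduced_order_homology:
  assumes "partial_order P" and van: "homology_vanishes (lless P) (order_complex P) p"
  shows "trivial_group (reduced_order_homology P p)"
proof -
  let ?C = "simplicial_chain_group (order_complex P) p"
  let ?Z = "simplicial_cycles (lless P) (order_complex P) p"
  let ?B = "simplicial_boundaries (lless P) (order_complex P) p"
  let ?S = "subgroup_generated ?C ?Z"
  interpret H: comm_group "reduced_order_homology P p"
    by (rule comm_group_reduced_order_homology [OF assms(1)])
  have "subgroup ?Z ?C"
  proof
    show "?Z \<subseteq> carrier ?C"
      by (auto simp: in_simplicial_cycles_iff simplicial_chain_group_def)
    show "x \<otimes>\<^bsub>?C\<^esub> y \<in> ?Z" if "x \<in> ?Z" "y \<in> ?Z" for x y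
      using that keys_add_subset [of x _ y]
      by (simp add: in_simplicial_cycles_iff simplicial_chain_group_def simplicial_boundary_add)
    show "\<one>\<^bsub>?C\<^esub> \<in> ?Z"
      by (simp add: in_simplicial_cycles_iff simplicial_chain_group_def)
    show "inv\<^bsub>?C\<^esub> x \<in> ?Z" if "x \<in> ?Z" for x
      using that
      by (simp add: in_simplicial_cycles_iff simplicial_chain_group_def simplicial_boundary_minus)
  qed
  then have "carrier ?S \<subseteq> ?B"
    using van by (simp add: subgroup.carrier_subgroup_generated_subgroup homology_vanishes_def)
  moreover have add: "x + y \<in> ?B" "x - y \<in> ?B" if "x \<in> ?B" "y \<in> ?B" for x y
    using that by (auto simp: in_simplicial_boundaries_iff)
      (metis simplicial_boundary_add simplicial_boundary_diff keys_add_subset keys_diff_subset)+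
  ultimately have "?B #>\<^bsub>?S\<^esub> x = ?B" if "x \<in> carrier ?S" for x
  proof -
    have "x \<in> ?B" using that \<open>carrier ?S \<subseteq> ?B\<close> by blast
    moreover have "y \<in> ?B #>\<^bsub>?S\<^esub> x" if "y \<in> ?B" for y
      \<comment> \<open>The coset representative is found by writing \<open>y\<close> as
        \<open>(y - x) + x\<close>.\<close>
      using add(2) [OF that \<open>x \<in> ?B\<close>]
      by (auto simp: r_coset_def simplicial_chain_group_def intro!: bexI [of _ "y - x"])
    ultimately show ?thesis
      using add(1) by (auto simp: r_coset_def simplicial_chain_group_def)
  qed
  then have "carrier (reduced_order_homology P p) \<subseteq> {?B}"
    by (auto simp: reduced_order_homology_def reduced_simplicial_homology_def FactGroup_def
        RCOSETS_def)
  then have "carrier (reduced_order_homology P p) = {\<one>\<^bsub>reduced_order_homology P p\<^esub>}"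
    using H.one_closed by blast
  then show ?thesis
    by (simp add: trivial_group_def)
qed

section \<open>Up-sets\<close>

definition up_set :: "('a, 'b) gorder_scheme \<Rightarrow> 'a set \<Rightarrow> bool"
  where "up_set P Q \<longleftrightarrow> Q \<subseteq> carrier P \<and> (\<forall>x\<in>Q. \<forall>y\<in>carrier P. x \<sqsubseteq>\<^bsub>P\<^esub> y \<longrightarrow> y \<in> Q)"

lemma up_set_subset: "up_set P Q \<Longrightarrow> Q \<subseteq> carrier P"
  by (simp add: up_set_def)

lemma up_setD: "up_set P Q \<Longrightarrow> x \<in> Q \<Longrightarrow> y \<in> carrier P \<Longrightarrow> x \<sqsubseteq>\<^bsub>P\<^esub> y \<Longrightarrow> y \<in> Q"
  by (simp add: up_set_def)

lemma up_set_Int: "up_set P U \<Longrightarrow> up_set P V \<Longrightarrow> up_set P (U \<inter> V)"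
  by (auto simp: up_set_def)

definition up_closure :: "('a, 'b) gorder_scheme \<Rightarrow> 'a set \<Rightarrow> 'a set"
  where "up_closure P A = {x \<in> carrier P. \<exists>a\<in>A. a \<sqsubseteq>\<^bsub>P\<^esub> x}"

abbreviation subposet :: "('a, 'b) gorder_scheme \<Rightarrow> 'a set \<Rightarrow> ('a, 'b) gorder_scheme"
  where "subposet P Q \<equiv> P\<lparr>carrier := Q\<rparr>"

text \<open>The orientation is taken from all of \<open>P\<close>, so the complexes of different
  subsets share one boundary map.\<close>

abbreviation poset_homology_vanishes :: "('a, 'b) gorder_scheme \<Rightarrow> 'a set \<Rightarrow> int \<Rightarrow> bool"
  where "poset_homology_vanishes P Q p \<equiv>
    homology_vanishes (lless P) (order_complex (subposet P Q)) p"

lemma order_chain_subposet: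
  "order_chain (subposet P Q) C \<longleftrightarrow>
    C \<subseteq> Q \<and> (\<forall>x\<in>C. \<forall>y\<in>C. x \<sqsubseteq>\<^bsub>P\<^esub> y \<or> y \<sqsubseteq>\<^bsub>P\<^esub> x)"
  by (simp add: order_chain_def)

lemma order_complex_subset: "s \<in> order_complex P \<Longrightarrow> t \<subseteq> s \<Longrightarrow> t \<in> order_complex P"
  unfolding order_complex_def order_chain_def by blast

text \<open>If a chain had \<open>x\<close> outside \<open>U\<close> and \<open>y\<close> outside
  \<open>V\<close>, then \<open>x\<close> would lie in \<open>V\<close> and \<open>y\<close> in
  \<open>U\<close>, and the larger of the two would lie in both. Arguing this way covers infinite
  chains, which need not have a least element.\<close>

lemma order_complex_Un:
  assumes "up_set P U" "up_set P V"
  shows "order_complex (subposet P (U \<union> V)) =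
    order_complex (subposet P U) \<union> order_complex (subposet P V)"
proof -
  have split: "C \<subseteq> U \<or> C \<subseteq> V" if C: "order_chain (subposet P (U \<union> V)) C" for C
  proof (rule ccontr)
    assume "\<not> (C \<subseteq> U \<or> C \<subseteq> V)"
    then obtain x y where xy: "x \<in> C" "x \<notin> U" "y \<in> C" "y \<notin> V"
      by blast
    then have "x \<sqsubseteq>\<^bsub>P\<^esub> y \<or> y \<sqsubseteq>\<^bsub>P\<^esub> x" "x \<in> V" "y \<in> U"
      using C by (auto simp: order_chain_subposet)
    then show False
      using xy up_setD [OF assms(1), of y x] up_setD [OF assms(2), of x y]
        up_set_subset [OF assms(1)] up_set_subset [OF assms(2)]
      by blast
  qed
  show ?thesis
  proof (intro equalityI subsetI)
    fix C assume "C \<in> order_complex (subposet P (U \<union> V))"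
    with split [of C]
    show "C \<in> order_complex (subposet P U) \<union> order_complex (subposet P V)"
      by (simp add: order_complex_def) (simp add: order_chain_subposet)
  next
    fix C assume "C \<in> order_complex (subposet P U) \<union> order_complex (subposet P V)"
    then show "C \<in> order_complex (subposet P (U \<union> V))"
      by (auto simp: order_complex_def order_chain_subposet)
  qed
qed

lemma order_complex_Int:
  "order_complex (subposet P (U \<inter> V)) =
    order_complex (subposet P U) \<inter> order_complex (subposet P V)"
  by (auto simp: order_complex_def order_chain_subposet)

lemma up_set_up_closure:
  assumes "partial_order P" "A \<subseteq> carrier P"
  shows "up_set P (up_closure P A)"
proof -
  interpret partial_order P by fact
  show ?thesis
    unfolding up_set_def up_closure_def using assms(2) by (blast intro: le_trans)
qed

section \<open>Mayer-Vietoris and cones for subsets of a poset\<close>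

lemma poset_homology_vanishes_Un:
  assumes "partial_order P" "up_set P U" "up_set P V"
    and "poset_homology_vanishes P U p" "poset_homology_vanishes P V p"
    and "poset_homology_vanishes P (U \<inter> V) (p - 1)"
  shows "poset_homology_vanishes P (U \<union> V) p"
  unfolding order_complex_Un [OF assms(2,3)]
proof (rule homology_vanishes_Un)
  interpret partial_order P by fact
  show "x \<sqsubset>\<^bsub>P\<^esub> y \<longleftrightarrow> \<not> y \<sqsubset>\<^bsub>P\<^esub> x"
    if "s \<in> order_complex (subposet P U)" "x \<in> s" "y \<in> s" "x \<noteq> y" for s x y
  proof -
    have "x \<in> carrier P" "y \<in> carrier P" "x \<sqsubseteq>\<^bsub>P\<^esub> y \<or> y \<sqsubseteq>\<^bsub>P\<^esub> x"
      using that assms(2) by (auto simp: order_complex_def order_chain_subposet up_set_def)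
    then show ?thesis
      using that(4) le_antisym [of x y] unfolding lless_eq by blast
  qed
qed (use assms order_complex_subset in \<open>auto simp flip: order_complex_Int\<close>)

text \<open>The order complex is a cone with apex \<open>a\<close>.\<close>

lemma poset_homology_vanishes_least:
  assumes "partial_order P" "Q \<subseteq> carrier P" "a \<in> Q" "\<And>x. x \<in> Q \<Longrightarrow> a \<sqsubseteq>\<^bsub>P\<^esub> x"
  shows "poset_homology_vanishes P Q p"
proof (rule homology_vanishes_cone)
  interpret partial_order P by fact
  show "insert a s \<in> order_complex (subposet P Q)" if "s \<in> order_complex (subposet P Q)" for s
    using that assms(3,4) by (auto simp: order_complex_def order_chain_subposet)
  show "a \<sqsubset>\<^bsub>P\<^esub> x \<and> \<not> x \<sqsubset>\<^bsub>P\<^esub> a"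
    if "s \<in> order_complex (subposet P Q)" "x \<in> s" "x \<noteq> a" for s x
  proof -
    have "x \<in> Q" using that by (auto simp: order_complex_def order_chain_subposet)
    then show ?thesis
      using assms(2,3) assms(4) [of x] that(3) le_antisym [of a x] unfolding lless_eq by auto
  qed
  show "\<not> a \<sqsubset>\<^bsub>P\<^esub> a"
    unfolding lless_eq by simp
qed

text \<open>The join of \<open>a\<close> and \<open>b\<close> in \<open>adjoin_top P\<close> is
  either an element of \<open>P\<close>, which generates the intersection, or the new top, and then
  the intersection is empty. A set \<open>J\<close> of at most one generator records both cases,
  ready for counting.\<close>

lemma up_closure_Int_up_closure:
  assumes "almost_join_based_lattice P" "a \<in> carrier P" "b \<in> carrier P"
  shows "\<exists>J. finite J \<and> card J \<le> 1 \<and> J \<subseteq> carrier P \<and>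
    up_closure P {a} \<inter> up_closure P {b} = up_closure P J"
proof -
  interpret L: upper_semilattice "adjoin_top P"
    using assms(1) by (simp add: almost_join_based_lattice_def)
  interpret partial_order P
    using assms(1) by (simp add: almost_join_based_lattice_def)
  obtain s where s: "least (adjoin_top P) s (Upper (adjoin_top P) {Some a, Some b})"
    using L.sup_of_two_exists [of "Some a" "Some b"] assms(2,3) by (auto simp: adjoin_top_def)
  have s_le: "s \<sqsubseteq>\<^bsub>adjoin_top P\<^esub> Some x"
    if "x \<in> carrier P" "a \<sqsubseteq>\<^bsub>P\<^esub> x" "b \<sqsubseteq>\<^bsub>P\<^esub> x" for x
  proof -
    have "Some x \<in> Upper (adjoin_top P) {Some a, Some b}"
      using that by (auto simp: Upper_def adjoin_top_def)
    with s show ?thesis by (simp add: least_def)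
  qed
  show ?thesis
  proof (cases s)
    case None
    \<comment> \<open>A common upper bound in \<open>P\<close> would lie above the new top.\<close>
    have "\<not> (a \<sqsubseteq>\<^bsub>P\<^esub> x \<and> b \<sqsubseteq>\<^bsub>P\<^esub> x)" if "x \<in> carrier P" for x
      using s_le [of x] that by (auto simp: None adjoin_top_def)
    then show ?thesis
      by (intro exI [of _ "{}"]) (auto simp: up_closure_def)
  next
    case (Some c)
    have c: "c \<in> carrier P" "a \<sqsubseteq>\<^bsub>P\<^esub> c" "b \<sqsubseteq>\<^bsub>P\<^esub> c"
      using s assms(2,3) unfolding Some least_def Upper_def by (auto simp: adjoin_top_def)
    moreover have "c \<sqsubseteq>\<^bsub>P\<^esub> x" if "x \<in> carrier P" "a \<sqsubseteq>\<^bsub>P\<^esub> x" "b \<sqsubseteq>\<^bsub>P\<^esub> x" for x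
      using s_le [OF that] by (simp add: Some adjoin_top_def)
    ultimately show ?thesis
      using assms(2,3)
      by (intro exI [of _ "{c}"]) (auto simp: up_closure_def intro: le_trans [of _ c])
  qed
qed

text \<open>Mayer-Vietoris splits off one generator \<open>a\<close>. The part shared with the
  others is generated by their joins with \<open>a\<close>, so it has fewer generators, and it
  matters one dimension lower. Joins may coincide or be missing, hence an upper bound
  \<open>n\<close> instead of an exact count.\<close>

lemma homology_vanishes_up_closure:
  assumes P: "almost_join_based_lattice P"
    and "finite A" "A \<subseteq> carrier P" "card A \<le> n" "n \<ge> 1"
  shows "poset_homology_vanishes P (up_closure P A) (int n - 1)"
  using assms(2-)
proof (induction "card A" arbitrary: A n rule: less_induct)
  case less
  have po: "partial_order P"
    using P by (simp add: almost_join_based_lattice_def)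
  then interpret partial_order P .
  have cone: "poset_homology_vanishes P (up_closure P {a}) p" if "a \<in> carrier P" for a p
    using that by (intro poset_homology_vanishes_least [OF po, where a = a])
      (auto simp: up_closure_def)
  show ?case
  proof (cases "A = {}")
    case True
    \<comment> \<open>As \<open>n\<close> is at least 1, the dimension is at least 0, which excludes
      the empty simplex.\<close>
    have "simplices (order_complex (subposet P {})) (int n - 1) = {}"
      using less.prems(4) by (auto simp: simplices_def order_complex_def order_chain_subposet)
    with True show ?thesis
      by (intro homology_vanishesI exI [of _ 0]) (simp add: up_closure_def)
  next
    case False
    then obtain a B where A: "A = insert a B" "a \<notin> B"
      by (meson Set.set_insert ex_in_conv)
    have a: "a \<in> carrier P" and B: "B \<subseteq> carrier P" "finite B"
      using A less.prems by auto
    show ?thesis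
    proof (cases "B = {}")
      case True
      \<comment> \<open>A single generator is treated apart: the intersection would be empty here,
        and the empty poset has homology in dimension -1, which is the dimension required when
        \<open>n = 1\<close>.\<close>
      with A cone [OF a] show ?thesis by simp
    next
      case ne: False
      have cA: "card A = Suc (card B)"
        using A B by simp
      moreover have "card B \<noteq> 0"
        using ne B by simp
      ultimately have n: "card B \<le> n - 1" "n - 1 \<ge> 1" "int n - 1 - 1 = int (n - 1) - 1"
        using less.prems(3) by linarith+
      have "\<exists>J. finite J \<and> card J \<le> 1 \<and> J \<subseteq> carrier P \<and>
          up_closure P {b} \<inter> up_closure P {a} = up_closure P J" if "b \<in> B" for b
        using up_closure_Int_up_closure [OF P, of b a] that a B by blast
      then obtain J where J: "\<And>b. b \<in> B \<Longrightarrow> finite (J b)" "\<And>b. b \<in> B \<Longrightarrow> card (J b) \<le> 1"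
        "\<And>b. b \<in> B \<Longrightarrow> J b \<subseteq> carrier P"
        "\<And>b. b \<in> B \<Longrightarrow> up_closure P {b} \<inter> up_closure P {a} = up_closure P (J b)"
        by metis
      have "card (\<Union>b\<in>B. J b) \<le> (\<Sum>b\<in>B. card (J b))"
        by (rule card_UN_le [OF B(2)])
      also have "\<dots> \<le> card B"
        using sum_mono [of B "\<lambda>b. card (J b)" "\<lambda>_. 1"] J(2) by simp
      finally have cJ: "card (\<Union>b\<in>B. J b) \<le> card B" .
      have "up_closure P B \<inter> up_closure P {a} = (\<Union>b\<in>B. up_closure P {b} \<inter> up_closure P {a})"
        by (auto simp: up_closure_def)
      also have "\<dots> = up_closure P (\<Union>b\<in>B. J b)"
        using J(4) by (auto simp: up_closure_def)
      finally have meet: "up_closure P B \<inter> up_closure P {a} = up_closure P (\<Union>b\<in>B. J b)" .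
      have "poset_homology_vanishes P (up_closure P (\<Union>b\<in>B. J b)) (int (n - 1) - 1)"
        using J(1) B n cJ cA by (intro less.hyps) (auto intro: J(3) [THEN subsetD])
      then have "poset_homology_vanishes P (up_closure P B \<inter> up_closure P {a}) (int n - 1 - 1)"
        by (simp only: meet n(3))
      moreover have "poset_homology_vanishes P (up_closure P B) (int n - 1)"
        using B n cA less.prems by (intro less.hyps) auto
      moreover have "up_set P (up_closure P B)" "up_set P (up_closure P {a})"
        using a B by (auto intro!: up_set_up_closure [OF po])
      ultimately have "poset_homology_vanishes P (up_closure P B \<union> up_closure P {a}) (int n - 1)"
        using cone [OF a] by (intro poset_homology_vanishes_Un [OF po])
      moreover have "up_closure P B \<union> up_closure P {a} = up_closure P A"
        by (auto simp: up_closure_def A)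
      ultimately show ?thesis by simp
    qed
  qed
qed

section \<open>Counting maximal chains\<close>

text \<open>
  The induction counts elements of chains, \<open>n = k + 1\<close>, so that it can start at the empty poset,
  which has homology in dimension \<open>-1\<close>.
\<close>

definition long_maximal_chains :: "('a, 'b) gorder_scheme \<Rightarrow> nat \<Rightarrow> 'a set set"
  where "long_maximal_chains P n = {C. maximal_order_chain P C \<and> n \<le> card C}"

lemma finite_long_maximal_chains:
  assumes "finite (carrier P)"
  shows "finite (long_maximal_chains P n)"
  by (rule finite_subset [of _ "Pow (carrier P)"])
    (use assms in \<open>auto simp: long_maximal_chains_def maximal_order_chain_def order_chain_def\<close>)

text \<open>A maximal chain of \<open>Q - {a}\<close> can be enlarged in \<open>Q\<close> by
  \<open>a\<close> at most. Enlarging it when possible gives a maximal chain of \<open>Q\<close>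
  that is no shorter, and deleting \<open>a\<close> recovers the original, so the map is
  injective.\<close>

lemma card_long_maximal_chains_remove:
  assumes "finite Q"
  shows "card (long_maximal_chains (subposet P (Q - {a})) n) \<le>
    card (long_maximal_chains (subposet P Q) n)"
proof -
  let ?f = "\<lambda>C. if maximal_order_chain (subposet P Q) C then C else insert a C"
  have "?f C \<in> long_maximal_chains (subposet P Q) n"
    if C: "C \<in> long_maximal_chains (subposet P (Q - {a})) n" for C
  proof -
    have chain: "order_chain (subposet P (Q - {a})) C" and n: "n \<le> card C"
      and max: "\<And>D. order_chain (subposet P (Q - {a})) D \<Longrightarrow> C \<subseteq> D \<Longrightarrow> D = C"
      using C by (auto simp: long_maximal_chains_def maximal_order_chain_def)
    have sub: "C \<subseteq> Q - {a}"
      using chain by (simp add: order_chain_subposet)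
    have ext: "D = C \<or> D = insert a C" if "order_chain (subposet P Q) D" "C \<subseteq> D" for D
    proof -
      have "D - {a} = C"
        using that sub by (intro max) (auto simp: order_chain_subposet)
      then show ?thesis by blast
    qed
    have fin: "finite C"
      using sub assms finite_subset by blast
    show ?thesis
    proof (cases "maximal_order_chain (subposet P Q) C")
      case True
      with n show ?thesis by (simp add: long_maximal_chains_def)
    next
      case False
      have "order_chain (subposet P Q) C"
        using chain by (auto simp: order_chain_subposet)
      with False obtain D where "order_chain (subposet P Q) D" "C \<subseteq> D" "D \<noteq> C"
        by (auto simp: maximal_order_chain_def)
      with ext have "order_chain (subposet P Q) (insert a C)"
        by blast
      with ext have "maximal_order_chain (subposet P Q) (insert a C)"
        unfolding maximal_order_chain_def by blast
      moreover have "n \<le> card (insert a C)"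
        using n fin by (simp add: card_insert_if)
      ultimately show ?thesis
        using False by (simp add: long_maximal_chains_def)
    qed
  qed
  moreover have "inj_on ?f (long_maximal_chains (subposet P (Q - {a})) n)"
  proof (rule inj_on_inverseI [where g = "\<lambda>C. C - {a}"])
    fix C assume "C \<in> long_maximal_chains (subposet P (Q - {a})) n"
    then have "a \<notin> C"
      by (auto simp: long_maximal_chains_def maximal_order_chain_def order_chain_subposet)
    then show "?f C - {a} = C" by auto
  qed
  ultimately show ?thesis
    using assms
    by (intro card_inj_on_le [where f = ?f] finite_long_maximal_chains image_subsetI) simp_all
qed

section \<open>Minimal elements and the chains through them\<close>

definition minimal_elements :: "('a, 'b) gorder_scheme \<Rightarrow> 'a set"
  where "minimal_elements P =
    {a \<in> carrier P. \<forall>x\<in>carrier P. x \<sqsubseteq>\<^bsub>P\<^esub> a \<longrightarrow> x = a}"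

lemma ex_minimal_element_below:
  assumes "partial_order P" "finite (carrier P)" "x \<in> carrier P"
  obtains a where "a \<in> minimal_elements P" "a \<sqsubseteq>\<^bsub>P\<^esub> x"
proof -
  interpret partial_order P by fact
  let ?below = "\<lambda>x. {y \<in> carrier P. y \<sqsubseteq>\<^bsub>P\<^esub> x}"
  have "\<exists>a\<in>minimal_elements P. a \<sqsubseteq>\<^bsub>P\<^esub> x"
    using assms(3)
  proof (induction "card (?below x)" arbitrary: x rule: less_induct)
    case less
    show ?case
    proof (cases "x \<in> minimal_elements P")
      case True
      then show ?thesis using less.prems by blast
    next
      case False
      then obtain y where y: "y \<in> carrier P" "y \<sqsubseteq>\<^bsub>P\<^esub> x" "y \<noteq> x"
        using less.prems by (auto simp: minimal_elements_def)
      have "?below y \<subset> ?below x"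
        using y less.prems le_trans le_antisym by blast
      then have "card (?below y) < card (?below x)"
        using assms(2) by (intro psubset_card_mono) auto
      then obtain a where "a \<in> minimal_elements P" "a \<sqsubseteq>\<^bsub>P\<^esub> y"
        using less.hyps y(1) by blast
      moreover from this have "a \<sqsubseteq>\<^bsub>P\<^esub> x"
        using y less.prems le_trans [of a y x] by (simp add: minimal_elements_def)
      ultimately show ?thesis
        by blast
    qed
  qed
  with that show thesis by blast
qed

text \<open>In a chain through the minimal element \<open>a\<close>, everything else lies strictly
  above \<open>a\<close>. A larger chain therefore restricts to a chain above \<open>a\<close> that
  contains \<open>C\<close>, and maximality of \<open>C\<close> applies.\<close>

lemma long_maximal_chains_insert_minimal:
  assumes "partial_order P" "finite Q" "Q \<subseteq> carrier P" "a \<in> minimal_elements (subposet P Q)"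
    and C: "C \<in> long_maximal_chains (subposet P {x \<in> Q. a \<sqsubset>\<^bsub>P\<^esub> x}) n"
  shows "insert a C \<in> long_maximal_chains (subposet P Q) (Suc n)" "a \<notin> C"
proof -
  interpret partial_order P by fact
  let ?R = "{x \<in> Q. a \<sqsubset>\<^bsub>P\<^esub> x}"
  have a: "a \<in> Q" "a \<in> carrier P" and min: "\<And>x. x \<in> Q \<Longrightarrow> x \<sqsubseteq>\<^bsub>P\<^esub> a \<Longrightarrow> x = a"
    using assms(3,4) by (auto simp: minimal_elements_def)
  have chain: "order_chain (subposet P ?R) C" and n: "n \<le> card C"
    and max: "\<And>D. order_chain (subposet P ?R) D \<Longrightarrow> C \<subseteq> D \<Longrightarrow> D = C"
    using C by (auto simp: long_maximal_chains_def maximal_order_chain_def)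
  have sub: "C \<subseteq> ?R"
    using chain by (simp add: order_chain_subposet)
  show "a \<notin> C"
    using sub lless_eq by auto
  have "finite C"
    using sub assms(2) finite_subset by fastforce
  have "order_chain (subposet P Q) (insert a C)"
    using chain a unfolding order_chain_subposet lless_eq by auto
  moreover have "D = insert a C" if D: "order_chain (subposet P Q) D" "insert a C \<subseteq> D" for D
  proof -
    have "a \<sqsubset>\<^bsub>P\<^esub> x" if "x \<in> D" "x \<noteq> a" for x
    proof -
      have "x \<in> Q" "a \<sqsubseteq>\<^bsub>P\<^esub> x \<or> x \<sqsubseteq>\<^bsub>P\<^esub> a"
        using D that(1) unfolding order_chain_subposet by blast+
      then show ?thesis
        using that(2) min unfolding lless_eq by blast
    qed
    then have "D - {a} = C"
      using D \<open>a \<notin> C\<close> by (intro max) (auto simp: order_chain_subposet)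
    with D show ?thesis by blast
  qed
  ultimately have "maximal_order_chain (subposet P Q) (insert a C)"
    unfolding maximal_order_chain_def by blast
  then show "insert a C \<in> long_maximal_chains (subposet P Q) (Suc n)"
    using n \<open>finite C\<close> \<open>a \<notin> C\<close> by (simp add: long_maximal_chains_def)
qed

text \<open>Distinct minimal elements are incomparable, so a chain contains at most one of them.
  Hence \<open>insert a C\<close> determines both \<open>a\<close> and \<open>C\<close>.\<close>

lemma sum_long_maximal_chains_above_minimal:
  assumes "partial_order P" "finite Q" "Q \<subseteq> carrier P"
  shows "(\<Sum>a\<in>minimal_elements (subposet P Q).
      card (long_maximal_chains (subposet P {x \<in> Q. a \<sqsubset>\<^bsub>P\<^esub> x}) n))
    \<le> card (long_maximal_chains (subposet P Q) (Suc n))"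
proof -
  let ?M = "minimal_elements (subposet P Q)"
  let ?L = "\<lambda>a. long_maximal_chains (subposet P {x \<in> Q. a \<sqsubset>\<^bsub>P\<^esub> x}) n"
  have fin: "finite ?M"
    using assms(2) by (simp add: minimal_elements_def)
  note ins = long_maximal_chains_insert_minimal [OF assms]
  have "inj_on (\<lambda>(a, C). insert a C) (Sigma ?M ?L)"
  proof (rule inj_onI, clarify)
    fix a C b D
    assume *: "a \<in> ?M" "C \<in> ?L a" "b \<in> ?M" "D \<in> ?L b" "insert a C = insert b D"
    have "order_chain (subposet P Q) (insert a C)"
      using ins(1) [OF *(1,2)] by (simp add: long_maximal_chains_def maximal_order_chain_def)
    moreover have "a \<in> insert a C" "b \<in> insert a C"
      using *(5) by blast+
    ultimately have "a \<sqsubseteq>\<^bsub>P\<^esub> b \<or> b \<sqsubseteq>\<^bsub>P\<^esub> a"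
      unfolding order_chain_subposet by blast
    then have "a = b"
      using *(1,3) by (auto simp: minimal_elements_def)
    moreover have "a \<notin> C" "b \<notin> D"
      using * ins(2) by blast+
    ultimately show "a = b \<and> C = D"
      using *(5) by (simp add: insert_ident)
  qed
  then have "card (Sigma ?M ?L) \<le> card (long_maximal_chains (subposet P Q) (Suc n))"
    using ins(1) assms(2)
    by (intro card_inj_on_le [where f = "\<lambda>(a, C). insert a C"] finite_long_maximal_chains) auto
  moreover have "card (Sigma ?M ?L) = (\<Sum>a\<in>?M. card (?L a))"
    using fin assms(2) by (intro card_SigmaI ballI finite_long_maximal_chains) auto
  ultimately show ?thesis by simp
qed

text \<open>A finite up-set is generated by its minimal elements; with at most \<open>n\<close> of
  them its homology in dimension \<open>n - 1\<close> would vanish by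
  \<open>homology_vanishes_up_closure\<close>.\<close>

lemma card_minimal_elements_gt:
  assumes P: "almost_join_based_lattice P" and "finite Q" and up: "up_set P Q" and "n \<ge> 1"
    and "\<not> poset_homology_vanishes P Q (int n - 1)"
  shows "n < card (minimal_elements (subposet P Q))"
proof (rule ccontr)
  let ?M = "minimal_elements (subposet P Q)"
  assume "\<not> n < card ?M"
  moreover have M: "?M \<subseteq> Q"
    by (auto simp: minimal_elements_def)
  moreover have Q: "Q \<subseteq> carrier P"
    using up by (simp add: up_set_def)
  ultimately have "poset_homology_vanishes P (up_closure P ?M) (int n - 1)"
    using assms(2,4) finite_subset by (intro homology_vanishes_up_closure [OF P]) auto
  moreover have "up_closure P ?M = Q"
  proof
    show "up_closure P ?M \<subseteq> Q"
      using up M by (auto simp: up_closure_def up_set_def)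
    show "Q \<subseteq> up_closure P ?M"
    proof
      fix x assume x: "x \<in> Q"
      interpret partial_order P
        using P by (simp add: almost_join_based_lattice_def)
      have "partial_order (subposet P Q)"
        using Q by unfold_locales (auto simp: eq_is_equal intro: le_trans le_antisym)
      then obtain a where "a \<in> ?M" "a \<sqsubseteq>\<^bsub>subposet P Q\<^esub> x"
        by (rule ex_minimal_element_below [of "subposet P Q" x]) (use x assms(2) in auto)
      with x Q show "x \<in> up_closure P ?M"
        by (auto simp: up_closure_def)
    qed
  qed
  ultimately show False
    using assms(5) by simp
qed

text \<open>Mayer-Vietoris for \<open>Q - {a}\<close>, an up-set by minimality of \<open>a\<close>,
  and the cone \<open>?V\<close> of elements above \<open>a\<close>; they meet in the elements
  strictly above \<open>a\<close>.\<close>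

lemma poset_homology_vanishes_remove_minimal:
  assumes "partial_order P" "up_set P Q" "a \<in> minimal_elements (subposet P Q)"
    and "poset_homology_vanishes P (Q - {a}) p"
    and "poset_homology_vanishes P {x \<in> Q. a \<sqsubset>\<^bsub>P\<^esub> x} (p - 1)"
  shows "poset_homology_vanishes P Q p"
proof -
  interpret partial_order P by fact
  have a: "a \<in> Q" "Q \<subseteq> carrier P" "\<And>x. x \<in> Q \<Longrightarrow> x \<sqsubseteq>\<^bsub>P\<^esub> a \<Longrightarrow> x = a"
    using assms(2,3) by (auto simp: minimal_elements_def up_set_def)
  let ?V = "{x \<in> Q. a \<sqsubseteq>\<^bsub>P\<^esub> x}"
  have "up_set P (Q - {a})"
    using assms(2) a unfolding up_set_def by blast
  moreover have "?V = Q \<inter> up_closure P {a}"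
    using a by (auto simp: up_closure_def)
  then have "up_set P ?V"
    using assms(1,2) a by (auto intro!: up_set_Int up_set_up_closure)
  moreover have "poset_homology_vanishes P ?V p"
    using a by (intro poset_homology_vanishes_least [OF assms(1), where a = a]) auto
  moreover have "(Q - {a}) \<inter> ?V = {x \<in> Q. a \<sqsubset>\<^bsub>P\<^esub> x}" "(Q - {a}) \<union> ?V = Q"
    using a unfolding lless_eq by auto
  ultimately show ?thesis
    using poset_homology_vanishes_Un [OF assms(1), of "Q - {a}" ?V p] assms(4,5) by simp
qed

text \<open>The induction runs over up-sets of one fixed \<open>P\<close>, so the join property is
  never re-established: deleting a minimal element and passing to the elements strictly above one
  both lead to smaller up-sets.\<close>

lemma fact_le_card_long_maximal_chains:
  assumes P: "almost_join_based_lattice P"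
    and "finite Q" "up_set P Q" "\<not> poset_homology_vanishes P Q (int n - 1)"
  shows "fact (n + 1) \<le> card (long_maximal_chains (subposet P Q) n)"
  using assms(2-)
proof (induction "card Q" arbitrary: Q n rule: less_induct)
  case less
  have po: "partial_order P"
    using P by (simp add: almost_join_based_lattice_def)
  then interpret partial_order P .
  let ?M = "minimal_elements (subposet P Q)"
  let ?R = "\<lambda>a. {x \<in> Q. a \<sqsubset>\<^bsub>P\<^esub> x}"
  have Q: "Q \<subseteq> carrier P"
    using less.prems by (simp add: up_set_def)
  have R: "up_set P (?R a)" "card (?R a) < card Q" if "a \<in> Q" for a
  proof -
    have "y \<in> ?R a" if "x \<in> ?R a" "y \<in> carrier P" "x \<sqsubseteq>\<^bsub>P\<^esub> y" for x y
    proof -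
      have "a \<sqsubseteq>\<^bsub>P\<^esub> y" "a \<noteq> y"
        using that Q \<open>a \<in> Q\<close> le_trans [of a x y] le_antisym [of a x]
        unfolding lless_eq by (auto simp: subset_iff)
      then show ?thesis
        using that up_setD [OF less.prems(2)] unfolding lless_eq by blast
    qed
    then show "up_set P (?R a)"
      using Q unfolding up_set_def by blast
    show "card (?R a) < card Q"
      using that less.prems(1) by (intro psubset_card_mono) (auto simp: lless_eq)
  qed
  show ?case
  proof (cases n)
    case 0
    \<comment> \<open>The dimension is -1, where only the empty poset has homology: for
      \<open>x\<close> in \<open>Q\<close>, the vertex \<open>{x}\<close> has the empty simplex as
      its boundary. The empty chain is then the one maximal chain required.\<close>
    have "Q = {}"
    proof (rule ccontr)
      assume "Q \<noteq> {}"
      then obtain x where x: "x \<in> Q" by blast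
      have "poset_homology_vanishes P Q (- 1)"
      proof (rule homology_vanishesI)
        fix c :: "'a set \<Rightarrow>\<^sub>0 int"
        assume "Poly_Mapping.keys c \<subseteq> simplices (order_complex (subposet P Q)) (- 1)"
        then have "Poly_Mapping.keys c \<subseteq> {{}}"
          by (auto simp: simplices_def)
        then have c: "c = frag_cmul (Poly_Mapping.lookup c {}) (frag_of {})"
          by (intro poly_mapping_eqI) (auto simp: lookup_frag_cmul lookup_frag_of in_keys_iff)
        have x_simplex: "{x} \<in> simplices (order_complex (subposet P Q)) (- 1 + 1)"
          using x Q by (auto simp: simplices_def order_complex_def order_chain_subposet)
        have no_less: "{y \<in> {x}. y \<sqsubset>\<^bsub>P\<^esub> x} = {}"
          by (auto simp: lless_eq)
        have "simplicial_boundary (lless P) (frag_of {x}) =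
            frag_cmul ((-1) ^ card {y \<in> {x}. y \<sqsubset>\<^bsub>P\<^esub> x}) (frag_of {})"
          unfolding simplicial_boundary_of by simp
        also have "\<dots> = frag_of {}"
          unfolding no_less by simp
        finally have "simplicial_boundary (lless P)
            (frag_cmul (Poly_Mapping.lookup c {}) (frag_of {x})) = c"
          using c by (simp add: simplicial_boundary_def frag_extend_cmul)
        moreover have "Poly_Mapping.keys (frag_cmul (Poly_Mapping.lookup c {}) (frag_of {x})) \<subseteq>
            simplices (order_complex (subposet P Q)) (- 1 + 1)"
          using x_simplex keys_cmul [of "Poly_Mapping.lookup c {}" "frag_of {x}"] by auto
        ultimately show "\<exists>d. Poly_Mapping.keys d \<subseteq>
              simplices (order_complex (subposet P Q)) (- 1 + 1) \<and>
            simplicial_boundary (lless P) d = c"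
          by blast
      qed
      with less.prems(3) 0 show False by simp
    qed
    then have "long_maximal_chains (subposet P Q) n = {{}}"
      by (auto simp: 0 long_maximal_chains_def maximal_order_chain_def order_chain_subposet)
    then show ?thesis
      by (simp add: 0)
  next
    case (Suc m)
    show ?thesis
    proof (cases "\<exists>a\<in>?M. poset_homology_vanishes P (?R a) (int m - 1)")
      case True
      then obtain a where a: "a \<in> ?M" "poset_homology_vanishes P (?R a) (int n - 1 - 1)"
        using Suc by auto
      then have aQ: "a \<in> Q" and min: "\<And>x. x \<in> Q \<Longrightarrow> x \<sqsubseteq>\<^bsub>P\<^esub> a \<Longrightarrow> x = a"
        by (auto simp: minimal_elements_def)
      \<comment> \<open>The elements above \<open>a\<close> contribute nothing in dimension
        \<open>n - 2\<close>, so deleting \<open>a\<close> cannot destroy the homology in dimension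
        \<open>n - 1\<close>.\<close>
      have "\<not> poset_homology_vanishes P (Q - {a}) (int n - 1)"
        using poset_homology_vanishes_remove_minimal [OF po less.prems(2) a(1) _ a(2)] less.prems(3)
        by blast
      moreover have "up_set P (Q - {a})"
        using less.prems(2) aQ min unfolding up_set_def by blast
      ultimately have "fact (n + 1) \<le> card (long_maximal_chains (subposet P (Q - {a})) n)"
        using less.prems(1) aQ by (intro less.hyps card_Diff1_less) auto
      also have "\<dots> \<le> card (long_maximal_chains (subposet P Q) n)"
        by (rule card_long_maximal_chains_remove [OF less.prems(1)])
      finally show ?thesis .
    next
      case False
      have "n + 1 \<le> card ?M"
        using card_minimal_elements_gt [OF P less.prems(1,2) _ less.prems(3)] Suc by simp
      \<comment> \<open>Here \<open>n = m + 1\<close>, so \<open>fact (m + 1)\<close> is the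
        factorial of \<open>n\<close>, and at least \<open>n + 1\<close> minimal elements supply the
        missing factor.\<close>
      then have "fact (n + 1) \<le> card ?M * fact (m + 1)"
        using mult_le_mono1 [of "n + 1" "card ?M" "fact (m + 1)"] by (simp add: Suc)
      also have "\<dots> = (\<Sum>a\<in>?M. fact (m + 1))"
        by simp
      also have "\<dots> \<le> (\<Sum>a\<in>?M. card (long_maximal_chains (subposet P (?R a)) m))"
      proof (rule sum_mono)
        fix a assume "a \<in> ?M"
        moreover from this have "a \<in> Q" by (simp add: minimal_elements_def)
        ultimately show "fact (m + 1) \<le> card (long_maximal_chains (subposet P (?R a)) m)"
          using False R less.prems(1) by (intro less.hyps) auto
      qed
      also have "\<dots> \<le> card (long_maximal_chains (subposet P Q) n)"
        using sum_long_maximal_chains_above_minimal [OF po less.prems(1) Q] Suc by simp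
      finally show ?thesis .
    qed
  qed
qed

theorem theorem26:
  fixes P :: "('a, 'b) gorder_scheme" and k :: nat
  assumes "finite (carrier P)"
    and "almost_join_based_lattice P"
    and "\<not> trivial_group (reduced_order_homology P (int k))"
  shows "fact (k + 2) \<le> card {C. maximal_order_chain P C \<and> chain_length C \<ge> int k}"
proof -
  have "partial_order P"
    using assms(2) by (simp add: almost_join_based_lattice_def)
  then have "\<not> poset_homology_vanishes P (carrier P) (int (k + 1) - 1)"
    using trivial_reduced_order_homology [of P "int k"] assms(3) by auto
  moreover have "up_set P (carrier P)"
    by (simp add: up_set_def)
  \<comment> \<open>Taking \<open>n = k + 1\<close> matches both shifts: the homology has dimension
    \<open>n - 1\<close>, and a chain of length at least \<open>k\<close> has at least
    \<open>n\<close> elements.\<close>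
  ultimately have "fact (k + 1 + 1) \<le> card (long_maximal_chains (subposet P (carrier P)) (k + 1))"
    using assms(1) by (intro fact_le_card_long_maximal_chains [OF assms(2)])
  moreover have "long_maximal_chains (subposet P (carrier P)) (k + 1) =
      {C. maximal_order_chain P C \<and> chain_length C \<ge> int k}"
    by (auto simp: long_maximal_chains_def chain_length_def)
  ultimately show ?thesis
    by simp
qed

end
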